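(* Let $\mathcal{E}=(N,C,\mathcal{A})$ be an approval-based multi-winner election and let $S\subseteq C$ be a non-empty set of candidates. Then the maximum-flow procedure described in the context, run on input $(\mathcal{E},S)$, terminates and returns exactly $\mathit{maximin}(\mathcal{E},S)$, whichever maximum flow is chosen in each iteration. Moreover, if $k$ is an integer with $1\le k\le |C|$ and $|S|\le k$, then the procedure solves at most $k$ maximum flow problems.
   Context: **Elections.** An approval-based multi-winner election is a tuple $\mathcal{E}=(N,C,\mathcal{A})$, where $N=\{1,\dots,n\}$ is a finite set of voters, $C$ is a non-empty finite set of candidates, and $\mathcal{A}=(A_1,\dots,A_n)$ with $A_i\subseteq C$ the set of candidates approved by voter $i$. For $S\subseteq C$, the restriction $\mathcal{E}|_S=(N_S,S,\mathcal{A}_S)$ is given by $N_S=\{i\in N: A_i\cap S\neq\emptyset\}$ and $\mathcal{A}_S=(A_{iS}:i\in N_S)$ with $A_{iS}=A_i\cap S$. **Maximin support value.** For non-empty $S\subseteq C$, $\mathcal{F}_{\mathcal{E},S}$ is the set of vote assignments, i.e. functions $\alpha:N\times S\to[0,1]$ such that (i) $\alpha(i,c)=0$ for each voter $i$ and each $c\in S\setminus A_i$, and (ii) $\sum_{c\in A_i\cap S}\alpha(i,c)=1$ for each voter $i$ with $A_i\cap S\neq\emptyset$. The support of $c\in S$ under $\alpha$ is $\mathit{supp}_\alpha(c)=\sum_{i\in N}\alpha(i,c)$, and $$\mathit{maximin}(\mathcal{E},S)=\max_{\alpha\in\mathcal{F}_{\mathcal{E},S}}\ \min_{c\in S}\mathit{supp}_\alpha(c).$$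 **Flows.** Given a directed graph $(V,E)$ with source $s$, sink $t$ and integer capacities $u(e)\ge 0$, a flow is a function $f:E\to\mathbb{N}=\{0,1,2,\dots\}$ with $f(e)\le u(e)$ for every $e\in E$ and with inflow equal to outflow at every vertex other than $s,t$. Its value is $\sum_{(v,t)\in E}f(v,t)$. A maximum flow is a flow of maximum value; a maximum flow problem is the task of finding one. **The procedure.** Input: $\mathcal{E}$ and a non-empty $S\subseteq C$. Initialise the current data $(N_S,S,\mathcal{A}_S)$ to $\mathcal{E}|_S$. Then repeat: 1. Build the flow network with vertex set $N_S\cup S\cup\{s,t\}$ (disjoint union) and edges: $(s,i)$ with capacity $|S|$ for each $i\in N_S$; $(i,c)$ with capacity $|S|$ for each $i\in N_S$ and $c\in A_{iS}$; $(c,t)$ with capacity $|N_S|$ for each $c\in S$. Compute a maximum flow $f$ (any one), and let $v=\sum_{c\in S}f(c,t)$. 2. If $v<|N_S|\,|S|$: let $\mathit{Drop}$ be the union of the sets $A_{iS}$ over all $i\in N_S$ with $\sum_{c\in A_{iS}}f(i,c)<|S|$; set $S'=S\setminus\mathit{Drop}$; replace the current data $(N_S,S,\mathcal{A}_S)$ by its restriction to $S'$ (so the new candidate set is $S'$, the new voters are those of the current voters with $A_{iS}\cap S'\ne\emptyset$, and their new approval sets are $A_{iS}\cap S'$); go to the next iteration. 3. Otherwise stop and return the rational number $|N_S|/|S|$ for the current $N_S$ and $S$. *)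

theory Defs
  imports Complex_Main "Graph_Theory.Digraph"
begin

record ('v, 'c) election =
  voters :: "'v set"
  cands :: "'c set"
  approval :: "'v \<Rightarrow> 'c set"

text \<open>The current data of the procedure are also of type \<^typ>\<open>('v, 'c) election\<close>, so nonemptiness
  of the candidate set is imposed here and not in the type; \<^const>\<open>approval\<close> is only meaningful
  on \<^const>\<open>voters\<close>.\<close>

definition approval_election :: "('v, 'c) election \<Rightarrow> bool" where
  "approval_election \<E> \<longleftrightarrow> finite (voters \<E>) \<and> finite (cands \<E>) \<and> cands \<E> \<noteq> {} \<and>
     (\<forall>i\<in>voters \<E>. approval \<E> i \<subseteq> cands \<E>)"

definition restriction :: "('v, 'c) election \<Rightarrow> 'c set \<Rightarrow> ('v, 'c) election" where
  "restriction \<E> S =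
     \<lparr>voters = {i \<in> voters \<E>. approval \<E> i \<inter> S \<noteq> {}}, cands = S,
      approval = (\<lambda>i. approval \<E> i \<inter> S)\<rparr>"


text \<open>Functions on a finite domain (assignments on \<open>N \<times> S\<close>, flows on the arcs) are total
  functions; their values outside that domain are neither constrained nor used.\<close>

definition vote_assignments :: "('v, 'c) election \<Rightarrow> 'c set \<Rightarrow> ('v \<times> 'c \<Rightarrow> real) set" where
  "vote_assignments \<E> S =
     {\<alpha>. (\<forall>i\<in>voters \<E>. \<forall>c\<in>S. \<alpha> (i, c) \<in> {0..1}) \<and>
         (\<forall>i\<in>voters \<E>. \<forall>c\<in>S - approval \<E> i. \<alpha> (i, c) = 0) \<and>
         (\<forall>i\<in>voters \<E>. approval \<E> i \<inter> S \<noteq> {} \<longrightarrow> (\<Sum>c\<in>approval \<E> i \<inter> S. \<alpha> (i, c)) = 1)}"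

definition supp :: "('v, 'c) election \<Rightarrow> ('v \<times> 'c \<Rightarrow> real) \<Rightarrow> 'c \<Rightarrow> real" where
  "supp \<E> \<alpha> c = (\<Sum>i\<in>voters \<E>. \<alpha> (i, c))"

text \<open>The maximum ranges over an infinite set, so it is the greatest element
  (\<^const>\<open>Greatest\<close>) and not \<^const>\<open>Max\<close>, which is meant for finite sets.\<close>

definition maximin :: "('v, 'c) election \<Rightarrow> 'c set \<Rightarrow> real" where
  "maximin \<E> S = (GREATEST x. \<exists>\<alpha>\<in>vote_assignments \<E> S. x = Min (supp \<E> \<alpha> ` S))"


definition is_flow ::
  "('a, 'b) pre_digraph \<Rightarrow> 'a \<Rightarrow> 'a \<Rightarrow> ('b \<Rightarrow> nat) \<Rightarrow> ('b \<Rightarrow> nat) \<Rightarrow> bool" where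
  "is_flow G s t u f \<longleftrightarrow> (\<forall>e\<in>arcs G. f e \<le> u e) \<and>
     (\<forall>v\<in>verts G - {s, t}. (\<Sum>e\<in>in_arcs G v. f e) = (\<Sum>e\<in>out_arcs G v. f e))"

definition flow_value :: "('a, 'b) pre_digraph \<Rightarrow> 'a \<Rightarrow> ('b \<Rightarrow> nat) \<Rightarrow> nat" where
  "flow_value G t f = (\<Sum>e\<in>in_arcs G t. f e)"

definition is_max_flow ::
  "('a, 'b) pre_digraph \<Rightarrow> 'a \<Rightarrow> 'a \<Rightarrow> ('b \<Rightarrow> nat) \<Rightarrow> ('b \<Rightarrow> nat) \<Rightarrow> bool" where
  "is_max_flow G s t u f \<longleftrightarrow> is_flow G s t u f \<and>
     (\<forall>g. is_flow G s t u g \<longrightarrow> flow_value G t g \<le> flow_value G t f)"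


datatype ('v, 'c) node = Source | Sink | Voter 'v | Cand 'c

definition network ::
  "('v, 'c) election \<Rightarrow> (('v, 'c) node, ('v, 'c) node \<times> ('v, 'c) node) pre_digraph" where
  "network D =
     \<lparr>verts = Voter ` voters D \<union> Cand ` cands D \<union> {Source, Sink},
      arcs = {(Source, Voter i) | i. i \<in> voters D} \<union>
             {(Voter i, Cand c) | i c. i \<in> voters D \<and> c \<in> approval D i} \<union>
             {(Cand c, Sink) | c. c \<in> cands D},
      tail = fst, head = snd\<rparr>"

fun capacity :: "('v, 'c) election \<Rightarrow> ('v, 'c) node \<times> ('v, 'c) node \<Rightarrow> nat" where
  "capacity D (Source, Voter i) = card (cands D)"
| "capacity D (Voter i, Cand c) = card (cands D)"
| "capacity D (Cand c, Sink) = card (voters D)"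
| "capacity D _ = 0"

definition max_flow ::
  "('v, 'c) election \<Rightarrow> (('v, 'c) node \<times> ('v, 'c) node \<Rightarrow> nat) \<Rightarrow> bool" where
  "max_flow D f \<longleftrightarrow> is_max_flow (network D) Source Sink (capacity D) f"

definition sink_flow ::
  "('v, 'c) election \<Rightarrow> (('v, 'c) node \<times> ('v, 'c) node \<Rightarrow> nat) \<Rightarrow> nat" where
  "sink_flow D f = (\<Sum>c\<in>cands D. f (Cand c, Sink))"

definition Drop ::
  "('v, 'c) election \<Rightarrow> (('v, 'c) node \<times> ('v, 'c) node \<Rightarrow> nat) \<Rightarrow> 'c set" where
  "Drop D f =
     (\<Union>i\<in>{i \<in> voters D. (\<Sum>c\<in>approval D i. f (Voter i, Cand c)) < card (cands D)}. approval D i)"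


datatype ('v, 'c) config = Running "('v, 'c) election" | Returned rat

text \<open>One step is one iteration of the loop, which solves exactly one maximum flow problem; the
  choice of the maximum flow \<open>f\<close> is the only nondeterminism. An iteration with an empty candidate
  set could not return (the quotient would be \<open>0 / 0\<close>), so such a configuration is stuck.\<close>

inductive iteration :: "('v, 'c) config \<Rightarrow> ('v, 'c) config \<Rightarrow> bool" where
  drop: "\<lbrakk>max_flow D f; sink_flow D f < card (voters D) * card (cands D)\<rbrakk>
    \<Longrightarrow> iteration (Running D) (Running (restriction D (cands D - Drop D f)))"
| return: "\<lbrakk>max_flow D f; \<not> sink_flow D f < card (voters D) * card (cands D); cands D \<noteq> {}\<rbrakk>
    \<Longrightarrow> iteration (Running D) (Returned (of_nat (card (voters D)) / of_nat (card (cands D))))"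

end

theory Submission
  imports Defs
begin

text \<open>Call \<open>x\<close> supportable on \<open>T\<close> if every voter can distribute total weight at most \<open>1\<close> over her
  approved candidates so that each candidate of \<open>T\<close> gets at least \<open>x\<close>; the maximin value is the
  greatest supportable number, since spare weight can always be spent. Given a maximum flow, let \<open>R\<close>
  be the set of candidates reachable in the residual network. There is no augmenting path, so the
  arcs from \<open>R\<close> to the sink are saturated, and all flow into \<open>R\<close> comes from voters who approve
  only members of \<open>R\<close>. Hence \<open>R\<close> can be supported with \<open>card N / card S\<close> by these voters alone,
  whereas \<open>S - R\<close> cannot be supported with more than that. Since the dropped set is contained in
  \<open>R\<close>, dropping does not change which numbers are supportable, and \<open>S - R\<close> survives.\<close>

section \<open>Supportable values\<close>

text \<open>Row sums are at most 1 rather than equal to 1, so that passing to a smaller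
  \<open>T\<close> needs no renormalisation. Column sums run over approving voters only, in place of
  requiring \<open>\<beta>\<close> to vanish at unapproved pairs.\<close>

definition supportable :: "('v, 'c) election \<Rightarrow> 'c set \<Rightarrow> real \<Rightarrow> bool" where
  "supportable D T x \<longleftrightarrow> (\<exists>\<beta>.
     (\<forall>i\<in>voters D. (\<forall>c\<in>approval D i \<inter> T. 0 \<le> \<beta> i c) \<and> (\<Sum>c\<in>approval D i \<inter> T. \<beta> i c) \<le> 1) \<and>
     (\<forall>c\<in>T. x \<le> (\<Sum>i | i \<in> voters D \<and> c \<in> approval D i. \<beta> i c)))"

text \<open>A voter removed by the restriction approves nothing in \<open>T\<close>: her row is
  empty and she enters no column. Hence all candidate sets met in a run can be compared inside the
  original election.\<close>

lemma supportable_restriction: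
  assumes "T \<subseteq> S"
  shows "supportable (restriction E S) T x \<longleftrightarrow> supportable E T x"
proof -
  have rows: "approval E i \<inter> S \<inter> T = approval E i \<inter> T" for i
    using assms by blast
  have cols: "{i. i \<in> voters E \<and> approval E i \<inter> S \<noteq> {} \<and> c \<in> approval E i \<and> c \<in> S} =
      {i. i \<in> voters E \<and> c \<in> approval E i}" if "c \<in> T" for c
    using that assms by blast
  have rows_all: "(\<forall>i\<in>{i \<in> voters E. approval E i \<inter> S \<noteq> {}}.
      (\<forall>c\<in>approval E i \<inter> T. 0 \<le> \<beta> i c) \<and> (\<Sum>c\<in>approval E i \<inter> T. \<beta> i c) \<le> 1) \<longleftrightarrow>
    (\<forall>i\<in>voters E. (\<forall>c\<in>approval E i \<inter> T. 0 \<le> \<beta> i c) \<and> (\<Sum>c\<in>approval E i \<inter> T. \<beta> i c) \<le> 1)"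
    for \<beta> :: "_ \<Rightarrow> _ \<Rightarrow> real"
  proof -
    have "(\<forall>c\<in>approval E i \<inter> T. 0 \<le> \<beta> i c) \<and> (\<Sum>c\<in>approval E i \<inter> T. \<beta> i c) \<le> 1"
      if "approval E i \<inter> S = {}" for i
    proof -
      have "approval E i \<inter> T = {}" using that assms by blast
      then show ?thesis by simp
    qed
    then show ?thesis by blast
  qed
  show ?thesis
    unfolding supportable_def restriction_def
    by (simp add: rows cols rows_all[simplified] cong: ball_cong)
qed

lemma supportable_mono:
  assumes "supportable D T x" "T' \<subseteq> T" "finite T"
  shows "supportable D T' x"
proof -
  from assms(1) obtain \<beta> where
    rows: "\<And>i. i \<in> voters D \<Longrightarrow> (\<forall>c\<in>approval D i \<inter> T. 0 \<le> \<beta> i c) \<and> (\<Sum>c\<in>approval D i \<inter> T. \<beta> i c) \<le> 1"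
    and cols: "\<forall>c\<in>T. x \<le> (\<Sum>i | i \<in> voters D \<and> c \<in> approval D i. \<beta> i c)"
    unfolding supportable_def by blast
  have "(\<Sum>c\<in>approval D i \<inter> T'. \<beta> i c) \<le> 1" if "i \<in> voters D" for i
  proof -
    have "(\<Sum>c\<in>approval D i \<inter> T'. \<beta> i c) \<le> (\<Sum>c\<in>approval D i \<inter> T. \<beta> i c)"
      by (rule sum_mono2) (use assms rows[OF that] in auto)
    then show ?thesis using rows[OF that] by simp
  qed
  then show ?thesis
    unfolding supportable_def using rows cols assms(2) by (intro exI[of _ \<beta>]) blast
qed

text \<open>Double counting: adding the column bounds over \<open>T\<close> and exchanging the sums
  leaves row sums, at most 1 for a voter approving a member of \<open>T\<close> and 0 for any
  other.\<close>

lemma supportable_average: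
  assumes "supportable D T x" "finite (voters D)" "finite T"
  shows "x * card T \<le> card {i \<in> voters D. approval D i \<inter> T \<noteq> {}}"
proof -
  from assms(1) obtain \<beta> where
    rows: "\<And>i. i \<in> voters D \<Longrightarrow> (\<Sum>c\<in>approval D i \<inter> T. \<beta> i c) \<le> 1"
    and cols: "\<And>c. c \<in> T \<Longrightarrow> x \<le> (\<Sum>i | i \<in> voters D \<and> c \<in> approval D i. \<beta> i c)"
    unfolding supportable_def by blast
  have "x * card T = (\<Sum>c\<in>T. x)" by simp
  also have "\<dots> \<le> (\<Sum>c\<in>T. \<Sum>i | i \<in> voters D \<and> c \<in> approval D i. \<beta> i c)"
    by (rule sum_mono) (rule cols)
  also have "\<dots> = (\<Sum>i\<in>voters D. \<Sum>c | c \<in> T \<and> c \<in> approval D i. \<beta> i c)"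
    by (rule sum.swap_restrict) (use assms in auto)
  also have "\<dots> = (\<Sum>i\<in>voters D. \<Sum>c\<in>approval D i \<inter> T. \<beta> i c)"
    by (intro sum.cong refl) auto
  also have "\<dots> = (\<Sum>i | i \<in> voters D \<and> approval D i \<inter> T \<noteq> {}. \<Sum>c\<in>approval D i \<inter> T. \<beta> i c)"
    by (rule sum.mono_neutral_right) (use assms in auto)
  also have "\<dots> \<le> (\<Sum>i | i \<in> voters D \<and> approval D i \<inter> T \<noteq> {}. 1)"
    by (rule sum_mono) (use rows in auto)
  finally show ?thesis by simp
qed

lemma supp_eq_sum_approving:
  assumes "\<alpha> \<in> vote_assignments D S" "finite (voters D)" "c \<in> S"
  shows "supp D \<alpha> c = (\<Sum>i | i \<in> voters D \<and> c \<in> approval D i. \<alpha> (i, c))"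
  unfolding supp_def
  by (rule sum.mono_neutral_right) (use assms in \<open>auto simp: vote_assignments_def\<close>)

lemma supportable_if_vote_assignment:
  assumes "\<alpha> \<in> vote_assignments D S" "finite (voters D)" "\<And>c. c \<in> S \<Longrightarrow> x \<le> supp D \<alpha> c"
  shows "supportable D S x"
proof -
  have "(\<Sum>c\<in>approval D i \<inter> S. \<alpha> (i, c)) \<le> 1" if "i \<in> voters D" for i
    using assms(1) that by (cases "approval D i \<inter> S = {}") (simp_all add: vote_assignments_def)
  moreover have "0 \<le> \<alpha> (i, c)" if "i \<in> voters D" "c \<in> S" for i c
    using assms(1) that by (simp add: vote_assignments_def)
  moreover have "x \<le> (\<Sum>i | i \<in> voters D \<and> c \<in> approval D i. \<alpha> (i, c))" if "c \<in> S" for c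
    using supp_eq_sum_approving[OF assms(1,2) that] assms(3)[OF that] by simp
  ultimately show ?thesis
    unfolding supportable_def by (intro exI[of _ "\<lambda>i c. \<alpha> (i, c)"]) blast
qed

text \<open>Each voter's unspent weight is divided equally among her approved candidates in
  \<open>S\<close>, which makes her row sum 1 and lowers no support.\<close>

lemma vote_assignment_if_supportable:
  assumes "supportable D S x" "finite (voters D)" "finite S"
  obtains \<alpha> where "\<alpha> \<in> vote_assignments D S" "\<And>c. c \<in> S \<Longrightarrow> x \<le> supp D \<alpha> c"
proof -
  from assms(1) obtain \<beta> where
    nonneg: "\<And>i c. i \<in> voters D \<Longrightarrow> c \<in> approval D i \<inter> S \<Longrightarrow> 0 \<le> \<beta> i c"
    and rows: "\<And>i. i \<in> voters D \<Longrightarrow> (\<Sum>c\<in>approval D i \<inter> S. \<beta> i c) \<le> 1"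
    and cols: "\<And>c. c \<in> S \<Longrightarrow> x \<le> (\<Sum>i | i \<in> voters D \<and> c \<in> approval D i. \<beta> i c)"
    unfolding supportable_def by blast
  \<comment> \<open>For a voter without approved candidates in \<open>S\<close> this is a division
    by 0, hence 0, so \<open>r i\<close> is nonnegative for every voter.\<close>
  define r where "r i = (1 - (\<Sum>c\<in>approval D i \<inter> S. \<beta> i c)) / card (approval D i \<inter> S)" for i
  define \<alpha> where "\<alpha> = (\<lambda>(i, c). if c \<in> approval D i then \<beta> i c + r i else 0)"
  have r: "0 \<le> r i" if "i \<in> voters D" for i
    using rows[OF that] by (simp add: r_def)
  have sum1: "(\<Sum>c\<in>approval D i \<inter> S. \<alpha> (i, c)) = 1" if "approval D i \<inter> S \<noteq> {}" for i
  proof -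
    have "card (approval D i \<inter> S) \<noteq> 0" using that assms(3) by simp
    then show ?thesis
      by (simp add: \<alpha>_def sum.distrib r_def del: card_0_eq card_eq_0_iff)
  qed
  have pos: "0 \<le> \<alpha> (i, c)" if "i \<in> voters D" "c \<in> S" for i c
    using nonneg r that by (simp add: \<alpha>_def)
  have le1: "\<alpha> (i, c) \<le> 1" if "i \<in> voters D" "c \<in> S" for i c
  proof (cases "c \<in> approval D i")
    case True
    have "\<alpha> (i, c) \<le> (\<Sum>c\<in>approval D i \<inter> S. \<alpha> (i, c))"
      by (rule member_le_sum) (use that True pos assms(3) in auto)
    then show ?thesis using sum1 True that by force
  qed (simp add: \<alpha>_def)
  have \<alpha>: "\<alpha> \<in> vote_assignments D S"
    using sum1 pos le1 by (auto simp: vote_assignments_def \<alpha>_def)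
  moreover have "x \<le> supp D \<alpha> c" if "c \<in> S" for c
  proof -
    have "x \<le> (\<Sum>i | i \<in> voters D \<and> c \<in> approval D i. \<beta> i c)" by (rule cols[OF that])
    also have "\<dots> \<le> (\<Sum>i | i \<in> voters D \<and> c \<in> approval D i. \<alpha> (i, c))"
      by (rule sum_mono) (use r in \<open>auto simp: \<alpha>_def\<close>)
    finally show ?thesis using supp_eq_sum_approving[OF \<alpha> assms(2) that] by simp
  qed
  ultimately show ?thesis using that by blast
qed

text \<open>\<open>Greatest\<close> is meaningful only if the maximum is attained. The assignment
  built from \<open>x\<close> has minimum at least \<open>x\<close>, while the minimum of any
  assignment is supportable and so at most \<open>x\<close>; this replaces a compactness
  argument.\<close>

lemma maximin_eqI:
  assumes "finite (voters D)" "finite S" "S \<noteq> {}"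
    and "supportable D S x" "\<And>y. supportable D S y \<Longrightarrow> y \<le> x"
  shows "maximin D S = x"
proof -
  have le: "Min (supp D \<alpha> ` S) \<le> x" if "\<alpha> \<in> vote_assignments D S" for \<alpha>
    by (rule assms(5), rule supportable_if_vote_assignment[OF that]) (use assms in auto)
  obtain \<alpha> where \<alpha>: "\<alpha> \<in> vote_assignments D S" "\<And>c. c \<in> S \<Longrightarrow> x \<le> supp D \<alpha> c"
    using vote_assignment_if_supportable[OF assms(4,1,2)] by blast
  have "x \<le> Min (supp D \<alpha> ` S)" using \<alpha>(2) assms(2,3) by simp
  with le[OF \<alpha>(1)] have "x = Min (supp D \<alpha> ` S)" by simp
  then show ?thesis
    unfolding maximin_def using \<alpha>(1) le by (intro Greatest_equality) auto
qed

section \<open>Flows as matrices\<close>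

definition row :: "('v, 'c) election \<Rightarrow> ('v \<Rightarrow> 'c \<Rightarrow> nat) \<Rightarrow> 'v \<Rightarrow> nat" where
  "row D g i = (\<Sum>c\<in>approval D i. g i c)"

definition col :: "('v, 'c) election \<Rightarrow> ('v \<Rightarrow> 'c \<Rightarrow> nat) \<Rightarrow> 'c \<Rightarrow> nat" where
  "col D g c = (\<Sum>i | i \<in> voters D \<and> c \<in> approval D i. g i c)"

abbreviation middle :: "(('v, 'c) node \<times> ('v, 'c) node \<Rightarrow> nat) \<Rightarrow> 'v \<Rightarrow> 'c \<Rightarrow> nat" where
  "middle f i c \<equiv> f (Voter i, Cand c)"

text \<open>The flow with prescribed values on the middle arcs: conservation forces row sums on the
  source arcs and column sums on the sink arcs.\<close>

fun flow_of :: "('v, 'c) election \<Rightarrow> ('v \<Rightarrow> 'c \<Rightarrow> nat) \<Rightarrow> ('v, 'c) node \<times> ('v, 'c) node \<Rightarrow> nat" where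
  "flow_of D g (Source, Voter i) = row D g i"
| "flow_of D g (Voter i, Cand c) = g i c"
| "flow_of D g (Cand c, Sink) = col D g c"
| "flow_of D g _ = 0"

lemma out_arcs_network:
  "i \<in> voters D \<Longrightarrow> out_arcs (network D) (Voter i) = (\<lambda>c. (Voter i, Cand c)) ` approval D i"
  "c \<in> cands D \<Longrightarrow> out_arcs (network D) (Cand c) = {(Cand c, Sink)}"
  by (auto simp: network_def)

lemma in_arcs_network:
  "i \<in> voters D \<Longrightarrow> in_arcs (network D) (Voter i) = {(Source, Voter i)}"
  "in_arcs (network D) (Cand c) =
    (\<lambda>i. (Voter i, Cand c)) ` {i. i \<in> voters D \<and> c \<in> approval D i}"
  "in_arcs (network D) Sink = (\<lambda>c. (Cand c, Sink)) ` cands D"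
  by (auto simp: network_def)

lemma flow_value_network: "flow_value (network D) Sink f = sink_flow D f"
  by (simp add: flow_value_def sink_flow_def in_arcs_network sum.reindex inj_on_def)

text \<open>A voter has a single incoming arc and a candidate a single outgoing one, so conservation
  fixes the flow on that arc as a row or a column sum.\<close>

lemma is_flow_network_iff:
  "is_flow (network D) Source Sink (capacity D) f \<longleftrightarrow>
    (\<forall>i\<in>voters D. f (Source, Voter i) \<le> card (cands D)) \<and>
    (\<forall>i\<in>voters D. \<forall>c\<in>approval D i. f (Voter i, Cand c) \<le> card (cands D)) \<and>
    (\<forall>c\<in>cands D. f (Cand c, Sink) \<le> card (voters D)) \<and>
    (\<forall>i\<in>voters D. f (Source, Voter i) = row D (middle f) i) \<and>
    (\<forall>c\<in>cands D. col D (middle f) c = f (Cand c, Sink))"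
proof -
  have "(\<forall>e\<in>arcs (network D). f e \<le> capacity D e) \<longleftrightarrow>
      (\<forall>i\<in>voters D. f (Source, Voter i) \<le> card (cands D)) \<and>
      (\<forall>i\<in>voters D. \<forall>c\<in>approval D i. f (Voter i, Cand c) \<le> card (cands D)) \<and>
      (\<forall>c\<in>cands D. f (Cand c, Sink) \<le> card (voters D))"
    by (simp add: network_def ball_Un) (safe; fastforce)
  moreover have "verts (network D) - {Source, Sink} = Voter ` voters D \<union> Cand ` cands D"
    by (auto simp: network_def)
  moreover have "(\<Sum>e\<in>(\<lambda>c. (Voter i, Cand c)) ` approval D i. f e) = row D (middle f) i" for i
    by (simp add: row_def sum.reindex inj_on_def)
  moreover have "(\<Sum>e\<in>(\<lambda>i. (Voter i, Cand c)) ` {i. i \<in> voters D \<and> c \<in> approval D i}. f e) =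
      col D (middle f) c" for c
    by (simp add: col_def sum.reindex inj_on_def)
  ultimately show ?thesis
    unfolding is_flow_def
    by (simp add: ball_Un out_arcs_network in_arcs_network cong: ball_cong)
qed

text \<open>The shape shared by all data of a run. Nonempty approval sets ensure that a voter with
  deficient row sum causes at least one candidate to be dropped.\<close>

definition current_data :: "('v, 'c) election \<Rightarrow> bool" where
  "current_data D \<longleftrightarrow> approval_election D \<and> (\<forall>i\<in>voters D. approval D i \<noteq> {})"

lemma current_dataD:
  assumes "current_data D"
  shows "finite (voters D)" "finite (cands D)" "cands D \<noteq> {}"
    "i \<in> voters D \<Longrightarrow> approval D i \<subseteq> cands D" "i \<in> voters D \<Longrightarrow> finite (approval D i)"
    "i \<in> voters D \<Longrightarrow> approval D i \<noteq> {}"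
  using assms finite_subset by (auto simp: current_data_def approval_election_def)

lemma sum_rows_eq_sum_cols:
  assumes "current_data D"
  shows "(\<Sum>i\<in>voters D. row D g i) = (\<Sum>c\<in>cands D. col D g c)"
proof -
  note D = current_dataD[OF assms]
  have "(\<Sum>c\<in>cands D. col D g c) = (\<Sum>i\<in>voters D. \<Sum>c | c \<in> cands D \<and> c \<in> approval D i. g i c)"
    unfolding col_def by (rule sum.swap_restrict) (use D in auto)
  also have "\<dots> = (\<Sum>i\<in>voters D. row D g i)"
    unfolding row_def by (intro sum.cong refl) (use D(4) in auto)
  finally show ?thesis by simp
qed

text \<open>The middle capacities follow from the row bounds, since an entry is at most its row sum;
  conservation holds by construction.\<close>

lemma is_flow_flow_of:
  assumes "current_data D"
    and "\<And>i. i \<in> voters D \<Longrightarrow> row D g i \<le> card (cands D)"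
    and "\<And>c. c \<in> cands D \<Longrightarrow> col D g c \<le> card (voters D)"
  shows "is_flow (network D) Source Sink (capacity D) (flow_of D g)"
proof -
  have "g i c \<le> card (cands D)" if "i \<in> voters D" "c \<in> approval D i" for i c
  proof -
    have "g i c \<le> row D g i"
      unfolding row_def by (rule member_le_sum) (use that current_dataD[OF assms(1)] in auto)
    then show ?thesis using assms(2)[OF that(1)] by simp
  qed
  then show ?thesis using assms by (simp add: is_flow_network_iff)
qed

lemma flow_rows_cols:
  assumes "is_flow (network D) Source Sink (capacity D) f"
  shows "i \<in> voters D \<Longrightarrow> row D (middle f) i \<le> card (cands D)"
    and "c \<in> cands D \<Longrightarrow> col D (middle f) c \<le> card (voters D)"
    and "sink_flow D f = (\<Sum>c\<in>cands D. col D (middle f) c)"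
  using assms by (auto simp: is_flow_network_iff sink_flow_def)

lemma max_flow_is_flow:
  "max_flow D f \<Longrightarrow> is_flow (network D) Source Sink (capacity D) f"
  by (simp add: max_flow_def is_max_flow_def)

text \<open>The zero flow exists, and flow values are natural numbers bounded by the total sink
  capacity, so a largest one is attained. This keeps a running configuration from being
  stuck.\<close>

lemma max_flow_exists:
  assumes "current_data D"
  obtains f where "max_flow D f"
proof -
  let ?P = "is_flow (network D) Source Sink (capacity D)"
  have "?P (flow_of D (\<lambda>_ _. 0))"
    by (rule is_flow_flow_of[OF assms]) (simp_all add: row_def col_def)
  moreover have "flow_value (network D) Sink f \<le> card (cands D) * card (voters D)" if "?P f" for f
    unfolding flow_value_network flow_rows_cols(3)[OF that]
    using sum_bounded_above[of "cands D" "col D (middle f)" "card (voters D)"]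
      flow_rows_cols(2)[OF that] by simp
  ultimately obtain f where "?P f" "\<forall>g. ?P g \<longrightarrow> flow_value (network D) Sink g \<le> flow_value (network D) Sink f"
    using ex_has_greatest_nat[of ?P _ "flow_value (network D) Sink" "Suc (card (cands D) * card (voters D))"]
    by (metis less_Suc_eq_le)
  then show ?thesis using that by (auto simp: max_flow_def is_max_flow_def)
qed

section \<open>Residual reachability\<close>

text \<open>One breadth-first round in the residual network, recorded on candidates only. A voter is
  reached through spare capacity on her source arc, or backwards from a reached candidate to whom
  she sends flow. Her forward arcs may be taken as open: if the row bounds hold, a full one exhausts
  her row, so she can only have been reached from its own endpoint.\<close>

definition grow :: "('v, 'c) election \<Rightarrow> ('v \<Rightarrow> 'c \<Rightarrow> nat) \<Rightarrow> 'c set \<Rightarrow> 'c set" where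
  "grow D g X = X \<union> (\<Union>i\<in>{i \<in> voters D. row D g i < card (cands D) \<or>
      (\<exists>c\<in>approval D i \<inter> X. 0 < g i c)}. approval D i)"

definition bump :: "('v \<Rightarrow> 'c \<Rightarrow> nat) \<Rightarrow> 'v \<Rightarrow> 'c \<Rightarrow> nat \<Rightarrow> 'v \<Rightarrow> 'c \<Rightarrow> nat" where
  "bump g j c x = g(j := (g j)(c := x))"

lemma row_bump_other: "i \<noteq> j \<Longrightarrow> row D (bump g j c x) i = row D g i"
  by (simp add: row_def bump_def)

text \<open>The additive form avoids truncated subtraction, as \<open>x\<close> may lie below the
  old entry.\<close>

lemma row_bump:
  assumes "finite (approval D j)" "c \<in> approval D j"
  shows "row D (bump g j c x) j + g j c = row D g j + x"
  using assms by (simp add: row_def bump_def sum.remove[of _ c])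

lemma col_bump_other: "d \<noteq> c \<Longrightarrow> col D (bump g j c x) d = col D g d"
  by (auto simp: col_def bump_def intro!: sum.cong)

lemma col_bump:
  assumes "finite (voters D)" "j \<in> voters D" "c \<in> approval D j"
  shows "col D (bump g j c x) c + g j c = col D g c + x"
proof -
  have "finite {i. i \<in> voters D \<and> c \<in> approval D i}" "j \<in> {i. i \<in> voters D \<and> c \<in> approval D i}"
    using assms by auto
  note s = sum.remove[OF this]
  show ?thesis unfolding col_def s by (simp add: bump_def)
qed

text \<open>The last conclusion, that columns outside the previous layer only grew, guarantees that the
  flow used by the next arc of a shortest augmenting path is still present.\<close>

lemma augment:
  assumes D: "current_data D"
    and rows: "\<And>i. i \<in> voters D \<Longrightarrow> row D g i \<le> card (cands D)"
  shows "c \<in> (grow D g ^^ Suc k) {} \<Longrightarrow> \<exists>h.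
    (\<forall>i\<in>voters D. row D h i \<le> card (cands D)) \<and>
    (\<forall>d. col D h d = (if d = c then Suc (col D g d) else col D g d)) \<and>
    (\<forall>i. \<forall>d. d \<notin> (grow D g ^^ k) {} \<longrightarrow> g i d \<le> h i d)"
proof (induction k arbitrary: c)
  case 0
  then obtain i where i: "i \<in> voters D" "c \<in> approval D i" "row D g i < card (cands D)"
    by (auto simp: grow_def)
  \<comment> \<open>The path is source, \<open>i\<close>, \<open>c\<close>: one more unit fits
    because row \<open>i\<close> is deficient.\<close>
  let ?h = "bump g i c (Suc (g i c))"
  have "row D ?h j \<le> card (cands D)" if "j \<in> voters D" for j
    using row_bump[of D i c g "Suc (g i c)"] row_bump_other[of j i D g c] i rows[OF that] current_dataD[OF D]
    by (cases "j = i") auto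
  moreover have "col D ?h d = (if d = c then Suc (col D g d) else col D g d)" for d
    using col_bump[of D i c g "Suc (g i c)"] col_bump_other[of d c D g i] i current_dataD[OF D] by auto
  moreover have "g j d \<le> ?h j d" for j d by (simp add: bump_def)
  ultimately show ?case by blast
next
  case (Suc k)
  let ?L = "\<lambda>k. (grow D g ^^ k) {}"
  show ?case
  proof (cases "c \<in> ?L (Suc k)")
    case True
    \<comment> \<open>The same \<open>h\<close> serves: layers increase, so the last conclusion only
      gets weaker.\<close>
    have "?L k \<subseteq> ?L (Suc k)" by (auto simp: grow_def)
    with Suc.IH[OF True] show ?thesis by blast
  next
    case False
    with Suc.prems obtain j b where j: "j \<in> voters D" "c \<in> approval D j"
      "row D g j < card (cands D) \<or> b \<in> approval D j \<inter> ?L (Suc k) \<and> 0 < g j b"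
      by (auto simp: grow_def[of _ _ "?L (Suc k)"] simp del: funpow.simps(2)
        simp: funpow.simps(2)[of "Suc k"])
    \<comment> \<open>Neither alternative is possible, since \<open>c\<close> would then lie in an
      earlier layer. So \<open>b\<close> is new in layer \<open>Suc k\<close>, and the last
      conclusion for \<open>h\<close> gives \<open>h j b\<close> at least
      \<open>g j b\<close>.\<close>
    have "c \<in> ?L (Suc k)" if "row D g j < card (cands D) \<or> b \<in> approval D j \<inter> ?L k \<and> 0 < g j b"
      using that j(1,2) by (auto simp: grow_def)
    with False j(3) have b: "b \<in> approval D j" "b \<in> ?L (Suc k)" "0 < g j b" "b \<notin> ?L k" by auto
    from Suc.IH[OF b(2)] obtain h where
      h: "\<And>i. i \<in> voters D \<Longrightarrow> row D h i \<le> card (cands D)"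
        "\<And>d. col D h d = (if d = b then Suc (col D g d) else col D g d)"
        "\<And>i d. d \<notin> ?L k \<Longrightarrow> g i d \<le> h i d" by blast
    have bc: "b \<noteq> c" using b(2) False by auto
    have hb: "0 < h j b" using h(3)[OF b(4), of j] b(3) by simp
    \<comment> \<open>The surplus unit in column \<open>b\<close> is handed on to \<open>c\<close>:
      voter \<open>j\<close> moves one unit from \<open>b\<close> to \<open>c\<close>, which keeps
      her row sum.\<close>
    let ?h = "bump h j b (h j b - 1)"
    let ?h' = "bump ?h j c (Suc (h j c))"
    have hc: "?h j c = h j c" using bc by (simp add: bump_def)
    have finj: "finite (approval D j)" using current_dataD(5)[OF D j(1)] .
    have "row D ?h' j = row D h j"
      using row_bump[OF finj b(1), of h "h j b - 1"] row_bump[OF finj j(2), of ?h "Suc (h j c)"]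
        hc hb by linarith
    then have "row D ?h' i \<le> card (cands D)" if "i \<in> voters D" for i
      using h(1)[OF that] by (cases "i = j") (simp_all add: row_bump_other)
    moreover have "col D ?h' d = (if d = c then Suc (col D g d) else col D g d)" for d
    proof -
      have "col D ?h b = col D g b"
        using col_bump[OF current_dataD(1)[OF D] j(1) b(1), of h "h j b - 1"] h(2)[of b] hb by simp
      then have "col D ?h d = col D g d" for d
        using h(2)[of d] by (cases "d = b") (simp_all add: col_bump_other)
      moreover have "col D ?h' c = Suc (col D ?h c)"
        using col_bump[OF current_dataD(1)[OF D] j(1,2), of ?h "Suc (h j c)"] hc by linarith
      ultimately show ?thesis by (simp add: col_bump_other)
    qed
    moreover have "g i d \<le> ?h' i d" if "d \<notin> ?L (Suc k)" for i d
    proof -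
      have "d \<noteq> b" using that b(2) by auto
      moreover have "d \<notin> ?L k" using that by (auto simp: grow_def)
      ultimately show ?thesis using h(3)[of d i] by (auto simp: bump_def)
    qed
    ultimately show ?thesis by blast
  qed
qed

text \<open>\<open>R\<close> is the union of all layers, so a further round does not leave it. An
  unsaturated column in a layer would let \<open>augment\<close> produce a flow of larger
  value.\<close>

lemma max_flow_cut:
  assumes D: "current_data D" and f: "max_flow D f"
  obtains R where "R \<subseteq> cands D"
    "\<forall>i\<in>voters D. row D (middle f) i < card (cands D) \<longrightarrow> approval D i \<subseteq> R"
    "\<forall>i\<in>voters D. \<forall>c\<in>approval D i \<inter> R. 0 < middle f i c \<longrightarrow> approval D i \<subseteq> R"
    "\<forall>c\<in>R. col D (middle f) c = card (voters D)"
proof -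
  let ?g = "middle f"
  let ?L = "\<lambda>k. (grow D ?g ^^ k) {}"
  note flow = flow_rows_cols[OF max_flow_is_flow[OF f]]
  have sub: "?L k \<subseteq> cands D" for k
    by (induction k) (use current_dataD(4)[OF D] in \<open>auto simp: grow_def\<close>)
  have step: "grow D ?g (?L k) \<subseteq> (\<Union>k. ?L k)" for k
    by (rule UN_upper[of "Suc k" UNIV ?L, simplified])
  have sat: "col D ?g c = card (voters D)" if c: "c \<in> ?L k" for c k
  proof (rule ccontr)
    assume "col D ?g c \<noteq> card (voters D)"
    moreover have cC: "c \<in> cands D" using sub c by blast
    ultimately have less: "col D ?g c < card (voters D)" using flow(2)[of c] by simp
    \<comment> \<open>Layer 0 is empty, so the index is a successor, as \<open>augment\<close>
      requires.\<close>
    from c obtain k' where "c \<in> ?L (Suc k')" by (cases k) auto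
    from augment[OF D flow(1) this] obtain h where
      h: "\<And>i. i \<in> voters D \<Longrightarrow> row D h i \<le> card (cands D)"
        "\<And>d. col D h d = (if d = c then Suc (col D ?g d) else col D ?g d)" by blast
    have "is_flow (network D) Source Sink (capacity D) (flow_of D h)"
      by (rule is_flow_flow_of[OF D h(1)]) (use h(2) flow(2) less in auto)
    then have "sink_flow D (flow_of D h) \<le> sink_flow D f"
      using f by (simp add: max_flow_def is_max_flow_def flow_value_network)
    moreover have "sink_flow D (flow_of D h) = (\<Sum>d\<in>cands D. col D h d)"
      by (simp add: sink_flow_def)
    moreover have "(\<Sum>d\<in>cands D. col D ?g d) < (\<Sum>d\<in>cands D. col D h d)"
      by (rule sum_strict_mono_ex1) (use h(2) cC current_dataD[OF D] in auto)
    ultimately show False using flow(3) by simp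
  qed
  show ?thesis
  proof (rule that[of "\<Union>k. ?L k"])
    show "(\<Union>k. ?L k) \<subseteq> cands D" using sub by blast
    show "\<forall>i\<in>voters D. row D ?g i < card (cands D) \<longrightarrow> approval D i \<subseteq> (\<Union>k. ?L k)"
    proof (intro ballI impI)
      fix i assume "i \<in> voters D" "row D ?g i < card (cands D)"
      then have "approval D i \<subseteq> grow D ?g (?L 0)" by (auto simp: grow_def)
      with step[of 0] show "approval D i \<subseteq> (\<Union>k. ?L k)" by (rule order_trans[rotated])
    qed
    have "approval D i \<subseteq> (\<Union>k. ?L k)"
      if "i \<in> voters D" "c \<in> approval D i" "c \<in> (\<Union>k. ?L k)" "0 < ?g i c" for i c
    proof -
      from that(3) obtain k where "c \<in> ?L k" by blast
      with that have "approval D i \<subseteq> grow D ?g (?L k)" by (auto simp: grow_def)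
      with step[of k] show ?thesis by (rule order_trans[rotated])
    qed
    then show "\<forall>i\<in>voters D. \<forall>c\<in>approval D i \<inter> (\<Union>k. ?L k). 0 < ?g i c \<longrightarrow>
        approval D i \<subseteq> (\<Union>k. ?L k)" by blast
    show "\<forall>c\<in>(\<Union>k. ?L k). col D ?g c = card (voters D)"
      using sat by blast
  qed
qed

section \<open>One iteration\<close>

text \<open>With N the voters and S the candidates, \<open>R\<close> receives |N||R| units, all from
  the voters \<open>?I\<close> approving only members of \<open>R\<close>, each sending at most |S|.
  The other voters \<open>?O\<close> are therefore at most |N||S - R|/|S| in number, and they alone
  can support S - \<open>R\<close>.\<close>

lemma supportable_on_surviving_le:
  assumes D: "current_data D" and R: "R \<subseteq> cands D" "R \<noteq> cands D"
    and rows: "\<And>i. i \<in> voters D \<Longrightarrow> row D g i \<le> card (cands D)"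
    and closed: "\<And>i c. \<lbrakk>i \<in> voters D; c \<in> approval D i; c \<in> R; 0 < g i c\<rbrakk> \<Longrightarrow> approval D i \<subseteq> R"
    and sat: "\<And>c. c \<in> R \<Longrightarrow> col D g c = card (voters D)"
    and x: "supportable D (cands D - R) x"
  shows "x * card (cands D) \<le> card (voters D)"
proof -
  note fin = current_dataD[OF D]
  let ?T = "cands D - R"
  let ?I = "{i \<in> voters D. approval D i \<subseteq> R}" and ?O = "{i \<in> voters D. approval D i \<inter> ?T \<noteq> {}}"
  have finR: "finite R" using R fin(2) finite_subset by blast
  have "card (voters D) * card R = (\<Sum>c\<in>R. col D g c)" by (simp add: sat)
  also have "\<dots> = (\<Sum>i\<in>voters D. \<Sum>c | c \<in> R \<and> c \<in> approval D i. g i c)"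
    unfolding col_def by (rule sum.swap_restrict) (use fin finR in auto)
  \<comment> \<open>By \<open>closed\<close>, a voter outside \<open>?I\<close> sends nothing into
    \<open>R\<close>.\<close>
  also have "\<dots> = (\<Sum>i\<in>?I. \<Sum>c | c \<in> R \<and> c \<in> approval D i. g i c)"
    by (rule sum.mono_neutral_right) (use fin(1) closed in \<open>auto intro!: sum.neutral dest: subsetD\<close>)
  also have "\<dots> \<le> (\<Sum>i\<in>?I. card (cands D))"
  proof (rule sum_mono)
    fix i assume i: "i \<in> ?I"
    then have "{c. c \<in> R \<and> c \<in> approval D i} = approval D i" by auto
    then show "(\<Sum>c | c \<in> R \<and> c \<in> approval D i. g i c) \<le> card (cands D)"
      using rows[of i] i by (simp add: row_def)
  qed
  finally have 1: "card (voters D) * card R \<le> card ?I * card (cands D)" by simp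
  have "voters D = ?I \<union> ?O" "?I \<inter> ?O = {}" using fin(4) by auto
  then have 2: "card (voters D) = card ?I + card ?O"
    using fin(1) card_Un_disjoint[of ?I ?O] by simp
  have 3: "card (cands D) = card R + card ?T"
    using R(1) fin(2) finR by (simp add: card_Diff_subset card_mono)
  have "real (card (voters D) * card R) \<le> real (card ?I * card (cands D))"
    using 1 of_nat_le_iff by blast
  \<comment> \<open>Both sides of fact 1 are subtracted from the product of the numbers of voters
    and candidates.\<close>
  then have 4: "real (card ?O) * card (cands D) \<le> real (card (voters D)) * card ?T"
    by (simp add: 2 3 algebra_simps)
  have "x * card ?T \<le> card ?O"
    by (rule supportable_average[OF x fin(1)]) (use fin in simp)
  then have "x * card ?T * card (cands D) \<le> real (card ?O) * card (cands D)"
    by (rule mult_right_mono) simp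
  with 4 have "(x * card (cands D)) * card ?T \<le> real (card (voters D)) * card ?T"
    by (simp add: mult_ac)
  moreover have "card ?T > 0" using R fin(2) by (auto simp: card_gt_0_iff)
  ultimately show ?thesis by simp
qed

text \<open>A value below the maximum forces a deficient row, so something is dropped; it also
  forces an unsaturated column, so \<open>R\<close> is not everything and some candidate survives.
  For supportability, voters inside \<open>R\<close> follow the scaled flow and all others keep
  their weights on the survivors.\<close>

lemma iteration_drop:
  assumes D: "current_data D" and f: "max_flow D f"
    and less: "sink_flow D f < card (voters D) * card (cands D)"
  shows "cands D \<inter> Drop D f \<noteq> {}" "cands D - Drop D f \<noteq> {}"
    "supportable D (cands D - Drop D f) x \<longleftrightarrow> supportable D (cands D) x"
proof -
  note fin = current_dataD[OF D]
  let ?g = "middle f" and ?n = "card (voters D)" and ?s = "card (cands D)"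
  note flow = flow_rows_cols[OF max_flow_is_flow[OF f]]
  obtain R where R: "R \<subseteq> cands D"
    "\<forall>i\<in>voters D. row D ?g i < ?s \<longrightarrow> approval D i \<subseteq> R"
    "\<forall>i\<in>voters D. \<forall>c\<in>approval D i \<inter> R. 0 < ?g i c \<longrightarrow> approval D i \<subseteq> R"
    "\<forall>c\<in>R. col D ?g c = ?n"
    by (rule max_flow_cut[OF D f])
  have closed: "approval D i \<subseteq> R"
    if "i \<in> voters D" "c \<in> approval D i" "c \<in> R" "0 < ?g i c" for i c
    using R(3) that by blast
  have sat: "col D ?g c = ?n" if "c \<in> R" for c
    using R(4) that by blast
  have Drop: "Drop D f = (\<Union>i\<in>{i \<in> voters D. row D ?g i < ?s}. approval D i)"
    by (simp add: Drop_def row_def)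
  have DropR: "Drop D f \<subseteq> R" unfolding Drop using R(2) by blast
  have RC: "R \<noteq> cands D"
  proof
    assume "R = cands D"
    then have "sink_flow D f = ?n * ?s" unfolding flow(3) by (simp add: sat)
    with less show False by simp
  qed
  show "cands D \<inter> Drop D f \<noteq> {}"
  proof -
    have "\<exists>i\<in>voters D. row D ?g i < ?s"
    proof (rule ccontr)
      assume "\<not> ?thesis"
      then have "(\<Sum>i\<in>voters D. ?s) \<le> (\<Sum>i\<in>voters D. row D ?g i)"
        by (intro sum_mono) (simp add: not_less)
      with less show False by (simp add: flow(3) sum_rows_eq_sum_cols[OF D])
    qed
    then obtain i where i: "i \<in> voters D" "row D ?g i < ?s" by blast
    then have "approval D i \<subseteq> Drop D f" unfolding Drop by blast
    with fin(4,6)[OF i(1)] show ?thesis by blast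
  qed
  show "cands D - Drop D f \<noteq> {}" using DropR R(1) RC by blast
  let ?S' = "cands D - Drop D f"
  have "supportable D (cands D) x" if x: "supportable D ?S' x"
  proof -
    have surviving: "supportable D (cands D - R) x"
      by (rule supportable_mono[OF x]) (use DropR fin(2) in auto)
    have xs: "x * ?s \<le> ?n"
      by (rule supportable_on_surviving_le[OF D R(1) RC flow(1) closed sat surviving])
    have s0: "0 < ?s" using fin by (simp add: card_gt_0_iff)
    from x obtain \<beta> where
      \<beta>: "\<And>i c. \<lbrakk>i \<in> voters D; c \<in> approval D i \<inter> ?S'\<rbrakk> \<Longrightarrow> 0 \<le> \<beta> i c"
        "\<And>i. i \<in> voters D \<Longrightarrow> (\<Sum>c\<in>approval D i \<inter> ?S'. \<beta> i c) \<le> 1"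
        "\<And>c. c \<in> ?S' \<Longrightarrow> x \<le> (\<Sum>i | i \<in> voters D \<and> c \<in> approval D i. \<beta> i c)"
      unfolding supportable_def by blast
    \<comment> \<open>Division by \<open>?s\<close> turns the row bound \<open>?s\<close> into 1 and
      a saturated column into \<open>?n / ?s\<close>, which is at least \<open>x\<close> by
      \<open>xs\<close>.\<close>
    define \<gamma> where "\<gamma> i c = (if approval D i \<subseteq> R then real (?g i c) / ?s
      else if c \<in> ?S' then \<beta> i c else 0)" for i c
    have rows: "(\<Sum>c\<in>approval D i \<inter> cands D. \<gamma> i c) \<le> 1" if i: "i \<in> voters D" for i
    proof (cases "approval D i \<subseteq> R")
      case True
      have "approval D i \<inter> cands D = approval D i" using fin(4)[OF i] by blast
      with True have "(\<Sum>c\<in>approval D i \<inter> cands D. \<gamma> i c) = row D ?g i / ?s"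
        by (simp add: \<gamma>_def row_def sum_divide_distrib)
      then show ?thesis using flow(1)[OF i] s0 by simp
    next
      case False
      have "(\<Sum>c\<in>approval D i \<inter> cands D. \<gamma> i c) = (\<Sum>c\<in>approval D i \<inter> ?S'. \<beta> i c)"
        by (rule sum.mono_neutral_cong_right) (use fin(2) False in \<open>auto simp: \<gamma>_def\<close>)
      then show ?thesis using \<beta>(2)[OF i] by simp
    qed
    have cols: "x \<le> (\<Sum>i | i \<in> voters D \<and> c \<in> approval D i. \<gamma> i c)" if c: "c \<in> cands D" for c
    proof (cases "c \<in> R")
      case True
      \<comment> \<open>If \<open>i\<close> sends flow to \<open>c\<close>, then
        \<open>closed\<close> puts her inside \<open>R\<close> and equality holds; otherwise the
        right-hand side is 0.\<close>
      have "\<gamma> i c \<ge> real (?g i c) / ?s" if "i \<in> voters D" "c \<in> approval D i" for i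
        using closed[OF that True] \<beta>(1)[of i c] that c by (cases "?g i c = 0") (auto simp: \<gamma>_def)
      then have "(\<Sum>i | i \<in> voters D \<and> c \<in> approval D i. real (?g i c) / ?s)
          \<le> (\<Sum>i | i \<in> voters D \<and> c \<in> approval D i. \<gamma> i c)"
        by (intro sum_mono) auto
      moreover have "(\<Sum>i | i \<in> voters D \<and> c \<in> approval D i. real (?g i c) / ?s) = real (col D ?g c) / ?s"
        by (simp add: col_def sum_divide_distrib)
      moreover have "x \<le> real ?n / ?s" using xs s0 by (simp add: pos_le_divide_eq)
      ultimately show ?thesis using sat[OF True] by simp
    next
      case False
      then have c': "c \<in> ?S'" using c DropR by blast
      \<comment> \<open>No approver of \<open>c\<close> lies inside \<open>R\<close>, so each of
        them uses \<open>\<beta>\<close>.\<close>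
      have "(\<Sum>i | i \<in> voters D \<and> c \<in> approval D i. \<gamma> i c) =
          (\<Sum>i | i \<in> voters D \<and> c \<in> approval D i. \<beta> i c)"
        by (rule sum.cong) (use False c' in \<open>auto simp: \<gamma>_def\<close>)
      then show ?thesis using \<beta>(3)[OF c'] by simp
    qed
    have "0 \<le> \<gamma> i c" if "i \<in> voters D" "c \<in> approval D i" for i c
      using \<beta>(1)[of i c] that by (auto simp: \<gamma>_def)
    with rows cols show ?thesis
      unfolding supportable_def by (intro exI[of _ \<gamma>]) blast
  qed
  moreover have "supportable D ?S' x" if "supportable D (cands D) x"
    by (rule supportable_mono[OF that]) (use fin in auto)
  ultimately show "supportable D ?S' x \<longleftrightarrow> supportable D (cands D) x" by blast
qed

text \<open>The flow value forces every column to be saturated, so the scaled flow attains the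
  quotient; averaging over all candidates shows that nothing larger is supportable.\<close>

lemma iteration_return:
  assumes D: "current_data D" and f: "max_flow D f"
    and ge: "\<not> sink_flow D f < card (voters D) * card (cands D)"
  shows "supportable D (cands D) (card (voters D) / card (cands D))"
    "supportable D (cands D) y \<Longrightarrow> y \<le> card (voters D) / card (cands D)"
proof -
  note fin = current_dataD[OF D]
  let ?g = "middle f" and ?n = "card (voters D)" and ?s = "card (cands D)"
  note flow = flow_rows_cols[OF max_flow_is_flow[OF f]]
  have s0: "0 < ?s" using fin by (simp add: card_gt_0_iff)
  have sat: "col D ?g c = ?n" if "c \<in> cands D" for c
  proof (rule ccontr)
    assume "col D ?g c \<noteq> ?n"
    with flow(2)[OF that] have "col D ?g c < ?n" by simp
    then have "(\<Sum>c\<in>cands D. col D ?g c) < (\<Sum>c\<in>cands D. ?n)"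
      by (intro sum_strict_mono_ex1) (use flow(2) that fin in auto)
    with ge show False by (simp add: flow(3) mult.commute)
  qed
  have "(\<Sum>c\<in>approval D i \<inter> cands D. real (?g i c) / ?s) \<le> 1" if i: "i \<in> voters D" for i
  proof -
    have "approval D i \<inter> cands D = approval D i" using fin(4)[OF i] by blast
    then have "(\<Sum>c\<in>approval D i \<inter> cands D. real (?g i c) / ?s) = row D ?g i / ?s"
      by (simp add: row_def sum_divide_distrib)
    then show ?thesis using flow(1)[OF i] s0 by simp
  qed
  moreover have "(\<Sum>i | i \<in> voters D \<and> c \<in> approval D i. real (?g i c) / ?s) = real ?n / ?s"
    if "c \<in> cands D" for c
    using sat[OF that] by (simp only: col_def sum_divide_distrib[symmetric] of_nat_sum[symmetric])
  ultimately show "supportable D (cands D) (real ?n / ?s)"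
    unfolding supportable_def by (intro exI[of _ "\<lambda>i c. real (?g i c) / ?s"]) simp
  show "y \<le> real ?n / ?s" if y: "supportable D (cands D) y"
  proof -
    have "card {i \<in> voters D. approval D i \<inter> cands D \<noteq> {}} \<le> ?n"
      by (rule card_mono) (use fin in auto)
    with supportable_average[OF y fin(1,2)] have "y * ?s \<le> ?n" by linarith
    then show ?thesis using s0 by (simp add: pos_le_divide_eq)
  qed
qed

section \<open>The whole run\<close>

lemma current_data_restriction:
  assumes "approval_election E" "T \<subseteq> cands E" "T \<noteq> {}"
  shows "current_data (restriction E T)"
  using assms finite_subset
  by (auto simp: current_data_def approval_election_def restriction_def)

lemma restriction_restriction:
  "T' \<subseteq> T \<Longrightarrow> restriction (restriction E T) T' = restriction E T'"
  by (auto simp: restriction_def fun_eq_iff)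

text \<open>Data are described as a restriction of the original election, which keeps the comparison
  of supportable numbers independent of the steps taken.\<close>

definition run_invariant :: "('v, 'c) election \<Rightarrow> 'c set \<Rightarrow> ('v, 'c) config \<Rightarrow> bool" where
  "run_invariant E S r \<longleftrightarrow> (case r of
     Running D \<Rightarrow> \<exists>T. T \<subseteq> S \<and> T \<noteq> {} \<and> D = restriction E T \<and>
       (\<forall>x. supportable E T x \<longleftrightarrow> supportable E S x)
   | Returned q \<Rightarrow> real_of_rat q = maximin E S)"

text \<open>Bounds the number of iterations still to come. Under the invariant it is positive while
  running, so the returning iteration lowers it too and is included in the count.\<close>

fun remaining :: "('v, 'c) config \<Rightarrow> nat" where
  "remaining (Running D) = card (cands D)"
| "remaining (Returned q) = 0"


lemma run_invariant_iteration:
  assumes E: "approval_election E" "S \<subseteq> cands E"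
    and inv: "run_invariant E S r" and it: "iteration r r'"
  shows "run_invariant E S r' \<and> remaining r' < remaining r"
  using it
proof cases
  case (drop D f)
  from inv drop(1) obtain T where T: "T \<subseteq> S" "T \<noteq> {}" "D = restriction E T"
    "\<And>x. supportable E T x \<longleftrightarrow> supportable E S x" by (auto simp: run_invariant_def)
  have D: "current_data D" unfolding T(3)
    by (rule current_data_restriction[OF E(1)]) (use T E in auto)
  have TD: "cands D = T" by (simp add: T(3) restriction_def)
  note step = iteration_drop[OF D drop(3,4), unfolded TD]
  let ?T' = "T - Drop D f"
  have "supportable E ?T' x \<longleftrightarrow> supportable E S x" for x
    using step(3)[of x] T(4) by (simp add: T(3) supportable_restriction)
  moreover have "restriction D ?T' = restriction E ?T'"
    by (simp add: T(3) restriction_restriction)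
  ultimately have "run_invariant E S r'"
    unfolding drop(2) TD run_invariant_def config.case using T(1) step(2)
    by (intro exI[of _ ?T'] conjI allI) auto
  moreover have "card ?T' < card T"
    using current_dataD(2)[OF D] step(1) TD by (intro psubset_card_mono) auto
  ultimately show ?thesis using drop TD by (simp add: restriction_def)
next
  case (return D f)
  from inv return(1) obtain T where T: "T \<subseteq> S" "T \<noteq> {}" "D = restriction E T"
    "\<And>x. supportable E T x \<longleftrightarrow> supportable E S x" by (auto simp: run_invariant_def)
  have D: "current_data D" unfolding T(3)
    by (rule current_data_restriction[OF E(1)]) (use T E in auto)
  have TD: "cands D = T" by (simp add: T(3) restriction_def)
  have DS: "supportable D (cands D) x \<longleftrightarrow> supportable E S x" for x
    unfolding TD T(4)[symmetric] by (simp add: T(3) supportable_restriction)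
  have "finite (voters E)" "finite S" "S \<noteq> {}"
    using E T(1,2) finite_subset by (auto simp: approval_election_def)
  \<comment> \<open>By \<open>DS\<close>, the quotient computed for the current data is also the
    greatest number supportable on \<open>S\<close> in \<open>E\<close>.\<close>
  then have "maximin E S = card (voters D) / card (cands D)"
    by (rule maximin_eqI) (use iteration_return[OF D return(3,4)] DS in auto)
  moreover have "0 < card (cands D)" using current_dataD(2,3)[OF D] by (simp add: card_gt_0_iff)
  ultimately show ?thesis
    using return by (simp add: run_invariant_def of_rat_divide)
qed

text \<open>Every iteration lowers \<open>remaining\<close> by at least 1; started at
  \<open>card S\<close>, this bounds the number of flow problems.\<close>

lemma run_invariant_relpowp:
  assumes "approval_election E" "S \<subseteq> cands E" "run_invariant E S r" "(iteration ^^ m) r r'"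
  shows "run_invariant E S r' \<and> remaining r' + m \<le> remaining r"
  using assms(4)
proof (induction m arbitrary: r')
  case 0
  with assms(3) show ?case by simp
next
  case (Suc m)
  then obtain r'' where "(iteration ^^ m) r r''" "iteration r'' r'" by auto
  with Suc.IH[of r''] run_invariant_iteration[OF assms(1,2), of r'' r'] show ?case by auto
qed

lemma run_invariant_termip:
  assumes "approval_election E" "S \<subseteq> cands E" "run_invariant E S r"
  shows "termip iteration r"
  using assms(3)
proof (induction r rule: measure_induct_rule[of remaining])
  case (less r)
  show ?case
    by (rule accp.accI) (use less run_invariant_iteration[OF assms(1,2)] in auto)
qed

text \<open>Under the invariant a running configuration has a maximum flow and a nonempty candidate
  set, so one of the two rules applies.\<close>

lemma run_invariant_stuck:
  assumes "approval_election E" "S \<subseteq> cands E" "run_invariant E S r" "\<nexists>r'. iteration r r'"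
  shows "\<exists>q. r = Returned q \<and> real_of_rat q = maximin E S"
proof (cases r)
  case (Running D)
  with assms(3) obtain T where T: "T \<subseteq> S" "T \<noteq> {}" "D = restriction E T"
    by (auto simp: run_invariant_def)
  have D: "current_data D" unfolding T(3)
    by (rule current_data_restriction[OF assms(1)]) (use T assms(2) in auto)
  obtain f where f: "max_flow D f" using max_flow_exists[OF D] by blast
  have "\<exists>r'. iteration r r'"
    unfolding Running
    using iteration.drop[OF f] iteration.return[OF f _ current_dataD(3)[OF D]] by blast
  with assms(4) show ?thesis by blast
next
  case (Returned q)
  with assms(3) show ?thesis by (simp add: run_invariant_def)
qed

theorem mainTheorem1:
  fixes \<E> :: "('v, 'c) election" and S :: "'c set"
  assumes "approval_election \<E>" and "S \<subseteq> cands \<E>" and "S \<noteq> {}"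
  shows "termip iteration (Running (restriction \<E> S)) \<and>
    (\<forall>r. iteration\<^sup>*\<^sup>* (Running (restriction \<E> S)) r \<and> (\<nexists>r'. iteration r r') \<longrightarrow>
      (\<exists>q. r = Returned q \<and> real_of_rat q = maximin \<E> S)) \<and>
    (\<forall>k. 1 \<le> k \<and> k \<le> card (cands \<E>) \<and> card S \<le> k \<longrightarrow>
      (\<forall>m r. (iteration ^^ m) (Running (restriction \<E> S)) r \<longrightarrow> m \<le> k))"
proof (intro conjI allI impI)
  let ?start = "Running (restriction \<E> S)"
  have start: "run_invariant \<E> S ?start"
    using assms(3) by (auto simp: run_invariant_def)
  have remaining: "remaining ?start = card S" by (simp add: restriction_def)
  show "termip iteration ?start"
    by (rule run_invariant_termip[OF assms(1,2) start])
  show "\<exists>q. r = Returned q \<and> real_of_rat q = maximin \<E> S"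
    if r: "iteration\<^sup>*\<^sup>* ?start r \<and> (\<nexists>r'. iteration r r')" for r
  proof -
    from r obtain m where "(iteration ^^ m) ?start r" using rtranclp_imp_relpowp by metis
    with run_invariant_relpowp[OF assms(1,2) start] have "run_invariant \<E> S r" by blast
    then show ?thesis using run_invariant_stuck[OF assms(1,2)] r by blast
  qed
  show "m \<le> k"
    if "1 \<le> k \<and> k \<le> card (cands \<E>) \<and> card S \<le> k" "(iteration ^^ m) ?start r" for k m r
    using run_invariant_relpowp[OF assms(1,2) start that(2)] that(1) remaining by simp
qed

end
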